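(* Suppose the original latencies satisfy $t_i<Vp_i$ for $i\in\{1,2\}$. If $P\le\min\{c_1/p_1,\,c_2/p_2\}$, then for throttled latencies $\hat t_1,\hat t_2$ with $\hat t_i>Vp_i$ for $i\in\{1,2\}$, one has $J^*_{post}\le J^*_{pre}$, where $$J^*_{pre}:=\min_{(i,s)}J_i\bigl(s,q^*(i,s;t_1,t_2)\bigr),\qquad J^*_{post}:=\min_{(i,s)}J_i\bigl(s,q^*(i,s;\hat t_1,\hat t_2)\bigr).$$
   Context: Two models $M_1,M_2$ have success probabilities $0<p_1<p_2<1$, original user latencies $t_1<t_2$ in $[0,1]$, and provider costs $c_1<c_2$ in $[0,1]$. A success is worth $V>0$ to the user and abandonment costs the provider a penalty $P>0$. A provider policy is a pair $(i,s)$ with $i\in\{1,2\}$ the initial model and $s\in[0,1]$ the probability of cascading from $M_1$ to $M_2$ after a failure of $M_1$ (irrelevant if $i=2$); minima are over $(i,s)\in\{1,2\}\times[0,1]$. The user chooses an abandonment probability $q\in[0,1]$. Let $\alpha(q):=(1-p_1)(1-q)$, $\beta(q):=\frac{1}{p_2+(1-p_2)q}$, and $$S_1(s,q)=\tfrac{p_1+\alpha(q)\beta(q)p_2 s}{1-\alpha(q)(1-s)},\quad C_1(s,q)=\tfrac{c_1+\alpha(q)\beta(q)c_2 s}{1-\alpha(q)(1-s)},\quad S_2(s,q)=\beta(q)p_2,\quad C_2(s,q)=\beta(q)c_2$$ (success probability and expected service cost). Provider cost: $J_i(s,q):=C_i(s,q)+P(1-S_i(s,q))$ (it does not depend on latencies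 directly). For latencies $(\tau_1,\tau_2)$, the expected delays are $L_1(s,q)=\frac{\tau_1+\alpha(q)\beta(q)\tau_2 s}{1-\alpha(q)(1-s)}$, $L_2(s,q)=\beta(q)\tau_2$, the user utility is $VS_i(s,q)-L_i(s,q)$, and $q^*(i,s;\tau_1,\tau_2)$ denotes a maximizer of this utility over $q\in[0,1]$. *)

theory Defs
  imports "HOL-Analysis.Analysis"
begin

datatype model = M1 | M2

definition alpha :: "(model \<Rightarrow> real) \<Rightarrow> real \<Rightarrow> real" where
  "alpha p q = (1 - p M1) * (1 - q)"

definition beta :: "(model \<Rightarrow> real) \<Rightarrow> real \<Rightarrow> real" where
  "beta p q = 1 / (p M2 + (1 - p M2) * q)"

text \<open>
  Success probability, service cost and delay share one formula: each is the expected total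
  of a quantity \<open>x j\<close> incurred at every call of model \<open>j\<close>, when the provider plays \<open>(i, s)\<close>
  and the user abandons with probability \<open>q\<close> after a failure.
\<close>

fun expected_total ::
  "(model \<Rightarrow> real) \<Rightarrow> (model \<Rightarrow> real) \<Rightarrow> model \<Rightarrow> real \<Rightarrow> real \<Rightarrow> real" where
  "expected_total p x M1 s q =
     (x M1 + alpha p q * beta p q * x M2 * s) / (1 - alpha p q * (1 - s))"
| "expected_total p x M2 s q = beta p q * x M2"

definition success_prob :: "(model \<Rightarrow> real) \<Rightarrow> model \<Rightarrow> real \<Rightarrow> real \<Rightarrow> real" where
  "success_prob p i s q = expected_total p p i s q"

definition service_cost ::
  "(model \<Rightarrow> real) \<Rightarrow> (model \<Rightarrow> real) \<Rightarrow> model \<Rightarrow> real \<Rightarrow> real \<Rightarrow> real" where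
  "service_cost p c i s q = expected_total p c i s q"

definition delay ::
  "(model \<Rightarrow> real) \<Rightarrow> (model \<Rightarrow> real) \<Rightarrow> model \<Rightarrow> real \<Rightarrow> real \<Rightarrow> real" where
  "delay p \<tau> i s q = expected_total p \<tau> i s q"

definition user_utility ::
  "(model \<Rightarrow> real) \<Rightarrow> real \<Rightarrow> (model \<Rightarrow> real) \<Rightarrow> model \<Rightarrow> real \<Rightarrow> real \<Rightarrow> real" where
  "user_utility p V \<tau> i s q = V * success_prob p i s q - delay p \<tau> i s q"

definition provider_cost ::
  "(model \<Rightarrow> real) \<Rightarrow> (model \<Rightarrow> real) \<Rightarrow> real \<Rightarrow> model \<Rightarrow> real \<Rightarrow> real \<Rightarrow> real" where
  "provider_cost p c P i s q = service_cost p c i s q + P * (1 - success_prob p i s q)"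

definition policies :: "(model \<times> real) set" where
  "policies = UNIV \<times> {0..1}"

text \<open>
  A best response selects, for every policy, some maximizer over \<open>[0, 1]\<close> of the user
  utility under the latencies \<open>\<tau>\<close>.
\<close>

definition best_response ::
  "(model \<Rightarrow> real) \<Rightarrow> real \<Rightarrow> (model \<Rightarrow> real) \<Rightarrow> (model \<times> real \<Rightarrow> real) \<Rightarrow> bool" where
  "best_response p V \<tau> qs \<longleftrightarrow>
     (\<forall>(i, s) \<in> policies. is_arg_max (user_utility p V \<tau> i s) (\<lambda>q. q \<in> {0..1}) (qs (i, s)))"

definition induced_cost ::
  "(model \<Rightarrow> real) \<Rightarrow> (model \<Rightarrow> real) \<Rightarrow> real \<Rightarrow> (model \<times> real \<Rightarrow> real) \<Rightarrow> model \<times> real \<Rightarrow> real" where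
  "induced_cost p c P qs \<pi> = provider_cost p c P (fst \<pi>) (snd \<pi>) (qs \<pi>)"

text \<open>
  This is the minimum of the induced cost only if a minimizing policy exists, so the
  existence of one has to be stated separately.
\<close>

definition optimal_cost ::
  "(model \<Rightarrow> real) \<Rightarrow> (model \<Rightarrow> real) \<Rightarrow> real \<Rightarrow> (model \<times> real \<Rightarrow> real) \<Rightarrow> real" where
  "optimal_cost p c P qs =
     induced_cost p c P qs (arg_min_on (induced_cost p c P qs) policies)"

lemma best_response_exists:
  assumes "0 < p M1" "p M1 < p M2" "p M2 < 1"
  shows "\<exists>qs. best_response p V \<tau> qs"
proof -
  have "\<exists>q. is_arg_max (user_utility p V \<tau> i s) (\<lambda>q. q \<in> {0..1}) q" if s: "s \<in> {0..1}" for i s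
  proof -
    have b: "p M2 + (1 - p M2) * q \<noteq> 0" if "q \<in> {0..1}" for q
    proof -
      have "0 \<le> (1 - p M2) * q" using that assms by simp
      then show ?thesis using assms by linarith
    qed
    have a: "(1 - p M1) * (1 - q) * (1 - s) \<noteq> 1" if q: "q \<in> {0..1}" for q
    proof -
      have "(1 - q) * (1 - s) \<le> 1" using q s by (intro mult_le_one) auto
      then have "(1 - p M1) * ((1 - q) * (1 - s)) \<le> 1 - p M1"
        using mult_left_mono[of "(1 - q) * (1 - s)" 1 "1 - p M1"] assms by simp
      then have "(1 - p M1) * (1 - q) * (1 - s) \<le> 1 - p M1"
        unfolding mult.assoc .
      then show ?thesis using assms by linarith
    qed
    have "continuous_on {0..1} (user_utility p V \<tau> i s)"
      unfolding user_utility_def success_prob_def delay_def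
      by (cases i) (auto simp: alpha_def beta_def a b intro!: continuous_intros)
    then obtain q where "q \<in> {0..1}"
        "\<forall>y\<in>{0..1}. user_utility p V \<tau> i s y \<le> user_utility p V \<tau> i s q"
      using continuous_attains_sup[of "{0..1::real}" "user_utility p V \<tau> i s"] by auto
    then show ?thesis by (auto simp: is_arg_max_linorder)
  qed
  then have "\<forall>\<pi>\<in>policies. \<exists>q.
      is_arg_max (user_utility p V \<tau> (fst \<pi>) (snd \<pi>)) (\<lambda>q. q \<in> {0..1}) q"
    by (auto simp: policies_def)
  then obtain qs where "\<forall>\<pi>\<in>policies.
      is_arg_max (user_utility p V \<tau> (fst \<pi>) (snd \<pi>)) (\<lambda>q. q \<in> {0..1}) (qs \<pi>)"
    by metis
  then show ?thesis
    unfolding best_response_def by (intro exI[of _ qs]) (auto simp: case_prod_beta)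
qed

end

theory Submission
  imports Defs
begin

text \<open>
  Utility and provider cost are both linear in the expected numbers of calls of the two models:
  the user gains \<open>V p\<^sub>j - \<tau>\<^sub>j\<close> per call of model \<open>j\<close>, and the provider pays
  \<open>c\<^sub>j - P p\<^sub>j\<close> per call on top of the constant \<open>P\<close>. Both numbers of calls decrease in \<open>q\<close>,
  at least one of them strictly. Hence the user never abandons under the original latencies
  (\<open>q = 0\<close>) and always abandons under the throttled ones (\<open>q = 1\<close>). The assumption on \<open>P\<close> makes
  the provider's cost per call nonnegative, so for every policy \<open>q = 1\<close> is cheapest.
\<close>

text \<open>Charging 1 for each call of \<open>j\<close> and 0 for the other model reuses the
  formula of \<open>expected_total\<close>. Starting from \<open>M1\<close>, the two values are
  \<open>1 / D\<close> and \<open>alpha p q * beta p q * s / D\<close> with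
  \<open>D = 1 - alpha p q * (1 - s)\<close>; starting from \<open>M2\<close>, they are
  \<open>0\<close> and \<open>beta p q\<close>.\<close>

definition calls :: "(model \<Rightarrow> real) \<Rightarrow> model \<Rightarrow> real \<Rightarrow> real \<Rightarrow> model \<Rightarrow> real" where
  "calls p i s q j = expected_total p (\<lambda>k. of_bool (k = j)) i s q"

lemma expected_total_eq_calls:
  "expected_total p x i s q = x M1 * calls p i s q M1 + x M2 * calls p i s q M2"
  by (cases i) (simp_all add: calls_def add_divide_distrib)

lemma user_utility_eq:
  "user_utility p V \<tau> i s q = expected_total p (\<lambda>j. V * p j - \<tau> j) i s q"
  by (simp add: user_utility_def success_prob_def delay_def expected_total_eq_calls algebra_simps)

lemma provider_cost_eq:
  "provider_cost p c P i s q = P + expected_total p (\<lambda>j. c j - P * p j) i s q"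
  by (simp add: provider_cost_def success_prob_def service_cost_def expected_total_eq_calls
      algebra_simps)

locale two_models =
  fixes p :: "model \<Rightarrow> real"
  assumes p1_pos: "0 < p M1" and p1_less_p2: "p M1 < p M2" and p2_less_1: "p M2 < 1"
begin

lemma alpha_nonneg: "q \<le> 1 \<Longrightarrow> 0 \<le> alpha p q"
  using p1_less_p2 p2_less_1 by (simp add: alpha_def)

lemma alpha_less_1:
  assumes "0 \<le> q"
  shows "alpha p q < 1"
proof -
  have "(1 - p M1) * (1 - q) \<le> (1 - p M1) * 1"
    using assms p1_less_p2 p2_less_1 by (intro mult_left_mono) auto
  then show ?thesis using p1_pos by (simp add: alpha_def)
qed

lemma alpha_strict_antimono: "q < q' \<Longrightarrow> alpha p q' < alpha p q"
  using p1_less_p2 p2_less_1 by (simp add: alpha_def)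

lemma beta_denominator_pos:
  assumes "0 \<le> q"
  shows "0 < p M2 + (1 - p M2) * q"
proof -
  have "0 \<le> (1 - p M2) * q" using assms p2_less_1 by simp
  then show ?thesis using p1_pos p1_less_p2 by linarith
qed

lemma beta_pos: "0 \<le> q \<Longrightarrow> 0 < beta p q"
  using beta_denominator_pos by (simp add: beta_def)

lemma beta_strict_antimono: "0 \<le> q \<Longrightarrow> q < q' \<Longrightarrow> beta p q' < beta p q"
  unfolding beta_def using beta_denominator_pos[of q] p2_less_1 by (intro frac_less2) auto

lemma alpha_beta_strict_antimono:
  assumes "0 \<le> q" "q < q'" "q' \<le> 1"
  shows "alpha p q' * beta p q' < alpha p q * beta p q"
  using assms alpha_nonneg[of q'] beta_pos[of q'] alpha_strict_antimono[of q q']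
    beta_strict_antimono[of q q']
  by (intro mult_strict_mono') auto

text \<open>Here \<open>alpha p q * (1 - s)\<close> is the chance that a call of \<open>M1\<close>
  is followed by another one, the ratio of a geometric series; it is at most
  \<open>alpha p q < 1\<close>.\<close>

lemma calls_denominator_pos:
  assumes "0 \<le> q" "q \<le> 1" "0 \<le> s" "s \<le> 1"
  shows "0 < 1 - alpha p q * (1 - s)"
proof -
  have "alpha p q * (1 - s) \<le> alpha p q"
    using assms alpha_nonneg[of q] by (intro mult_left_le) auto
  then show ?thesis using assms alpha_less_1[of q] by linarith
qed

lemma calls_denominator_mono:
  assumes "q < q'" "s \<le> 1"
  shows "1 - alpha p q * (1 - s) \<le> 1 - alpha p q' * (1 - s)"
  using assms alpha_strict_antimono[of q q'] by (simp add: mult_right_mono)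

text \<open>From \<open>M1\<close>, a larger \<open>q\<close> does not raise the numerators and does
  not lower the common denominator; from \<open>M2\<close> only \<open>beta\<close> matters.\<close>

lemma calls_antimono:
  assumes "0 \<le> q" "q \<le> q'" "q' \<le> 1" "0 \<le> s" "s \<le> 1"
  shows "calls p i s q' j \<le> calls p i s q j"
proof (cases "q = q'")
  case False
  then have "q < q'" using assms by simp
  note facts = this assms calls_denominator_pos[of q s] calls_denominator_mono[of q q' s]
    alpha_beta_strict_antimono[of q q'] alpha_nonneg[of q] beta_pos[of q]
    beta_strict_antimono[of q q']
  show ?thesis
  proof (cases i)
    case M1
    then show ?thesis using facts
      by (cases j) (auto simp: calls_def intro!: frac_le mult_right_mono)
  next
    case M2
    then show ?thesis using facts by (cases j) (auto simp: calls_def)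
  qed
qed simp

text \<open>Which \<open>j\<close> works depends on the policy. From \<open>M2\<close>, calls of
  \<open>M1\<close> are constantly 0. From \<open>M1\<close> with \<open>s = 1\<close> there is
  exactly one call of \<open>M1\<close>, so only \<open>M2\<close> can drop; with
  \<open>s < 1\<close> the calls of \<open>M1\<close> drop, whereas those of \<open>M2\<close> are
  constantly 0 when \<open>s = 0\<close>.\<close>

lemma calls_strict_antimono:
  assumes "0 \<le> q" "q < q'" "q' \<le> 1" "0 \<le> s" "s \<le> 1"
  shows "\<exists>j. calls p i s q' j < calls p i s q j"
proof (cases i)
  case M2
  then have "calls p i s q' M2 < calls p i s q M2"
    using assms beta_strict_antimono by (simp add: calls_def)
  then show ?thesis ..
next
  case i: M1
  show ?thesis
  proof (cases "s = 1")
    case True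
    then have "calls p i s q' M2 < calls p i s q M2"
      using i assms alpha_beta_strict_antimono by (simp add: calls_def)
    then show ?thesis ..
  next
    case False
    then have "1 - alpha p q * (1 - s) < 1 - alpha p q' * (1 - s)"
      using assms alpha_strict_antimono by simp
    then have "calls p i s q' M1 < calls p i s q M1"
      using i assms calls_denominator_pos[of q s]
      by (simp add: calls_def frac_less2)
    then show ?thesis ..
  qed
qed

lemma expected_total_antimono:
  assumes "\<And>j. 0 \<le> x j" "0 \<le> q" "q \<le> q'" "q' \<le> 1" "0 \<le> s" "s \<le> 1"
  shows "expected_total p x i s q' \<le> expected_total p x i s q"
  unfolding expected_total_eq_calls
  using assms by (intro add_mono mult_left_mono calls_antimono) auto

lemma expected_total_strict_antimono:
  assumes x: "\<And>j. 0 < x j" and q: "0 \<le> q" "q < q'" "q' \<le> 1" and s: "0 \<le> s" "s \<le> 1"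
  shows "expected_total p x i s q' < expected_total p x i s q"
proof -
  have weak: "x j * calls p i s q' j \<le> x j * calls p i s q j" for j
    using x[of j] q s by (intro mult_left_mono calls_antimono) auto
  obtain j where "calls p i s q' j < calls p i s q j"
    using calls_strict_antimono q s by blast
  then have "x j * calls p i s q' j < x j * calls p i s q j"
    using x by simp
  then show ?thesis
    unfolding expected_total_eq_calls using weak[of M1] weak[of M2] by (cases j) auto
qed

lemma best_response_maximizes:
  assumes "best_response p V \<tau> qs" "\<pi> \<in> policies" "q \<in> {0..1}"
  shows "qs \<pi> \<in> {0..1}"
    "user_utility p V \<tau> (fst \<pi>) (snd \<pi>) q \<le> user_utility p V \<tau> (fst \<pi>) (snd \<pi>) (qs \<pi>)"
  using assms by (auto simp: best_response_def is_arg_max_linorder case_prod_beta)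

lemma best_response_eq_0:
  assumes "best_response p V \<tau> qs" "\<And>j. \<tau> j < V * p j" "\<pi> \<in> policies"
  shows "qs \<pi> = 0"
proof (rule ccontr)
  note br = best_response_maximizes[OF assms(1,3), of 0]
  assume "qs \<pi> \<noteq> 0"
  then have "user_utility p V \<tau> (fst \<pi>) (snd \<pi>) (qs \<pi>) < user_utility p V \<tau> (fst \<pi>) (snd \<pi>) 0"
    unfolding user_utility_eq using assms br
    by (intro expected_total_strict_antimono) (auto simp: policies_def)
  then show False using br by simp
qed

lemma best_response_eq_1:
  assumes "best_response p V \<tau> qs" "\<And>j. V * p j < \<tau> j" "\<pi> \<in> policies"
  shows "qs \<pi> = 1"
proof (rule ccontr)
  note br = best_response_maximizes[OF assms(1,3), of 1]
  \<comment> \<open>The gains per call are now negative; after the sign change, the weights are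
    positive and strict antitonicity applies.\<close>
  have minus: "user_utility p V \<tau> (fst \<pi>) (snd \<pi>) q =
      - expected_total p (\<lambda>j. \<tau> j - V * p j) (fst \<pi>) (snd \<pi>) q" for q
    by (simp add: user_utility_eq expected_total_eq_calls algebra_simps)
  assume "qs \<pi> \<noteq> 1"
  then have "user_utility p V \<tau> (fst \<pi>) (snd \<pi>) (qs \<pi>) < user_utility p V \<tau> (fst \<pi>) (snd \<pi>) 1"
    unfolding minus neg_less_iff_less using assms br
    by (intro expected_total_strict_antimono) (auto simp: policies_def)
  then show False using br by simp
qed

lemma continuous_on_provider_cost:
  assumes "0 \<le> q" "q \<le> 1"
  shows "continuous_on {0..1} (\<lambda>s. provider_cost p c P i s q)"
proof -
  have "1 - alpha p q * (1 - s) \<noteq> 0" if "s \<in> {0..1}" for s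
    using calls_denominator_pos[of q s] that assms by auto
  then show ?thesis
    unfolding provider_cost_eq by (cases i) (auto intro!: continuous_intros)
qed

text \<open>A response that is constant on \<open>policies\<close> makes the cost continuous in
  \<open>s\<close>, so compactness yields a best \<open>s\<close> for each initial model, and the
  cheaper of the two candidates wins.\<close>

lemma exists_cheapest_policy:
  assumes "0 \<le> q" "q \<le> 1" "\<And>\<pi>. \<pi> \<in> policies \<Longrightarrow> qs \<pi> = q"
  shows "\<exists>\<pi>. is_arg_min (induced_cost p c P qs) (\<lambda>\<pi>. \<pi> \<in> policies) \<pi>"
proof -
  let ?J = "\<lambda>i s. provider_cost p c P i s q"
  have "\<exists>s\<in>{0..1}. \<forall>s'\<in>{0..1}. ?J i s \<le> ?J i s'" for i
    using assms(1,2) by (intro continuous_attains_inf continuous_on_provider_cost) auto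
  then obtain s where s: "\<And>i. s i \<in> {0..1}" "\<And>i s'. s' \<in> {0..1} \<Longrightarrow> ?J i (s i) \<le> ?J i s'"
    by metis
  obtain i where i: "\<And>j. ?J i (s i) \<le> ?J j (s j)"
    by (metis (full_types) linear model.exhaust)
  have "is_arg_min (induced_cost p c P qs) (\<lambda>\<pi>. \<pi> \<in> policies) (i, s i)"
    using assms(3) s order_trans[OF i s(2)]
    by (auto simp: is_arg_min_linorder induced_cost_def policies_def)
  then show ?thesis ..
qed

end

text \<open>\<open>arg_min_on\<close> is a choice operator, so existence of a minimizer must be
  known before its value can be compared with other policies.\<close>

lemma optimal_cost_mono:
  assumes "\<exists>\<pi>. is_arg_min (induced_cost p c P qs) (\<lambda>\<pi>. \<pi> \<in> policies) \<pi>"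
    and "\<exists>\<pi>. is_arg_min (induced_cost p c P qs') (\<lambda>\<pi>. \<pi> \<in> policies) \<pi>"
    and "\<And>\<pi>. \<pi> \<in> policies \<Longrightarrow> induced_cost p c P qs \<pi> \<le> induced_cost p c P qs' \<pi>"
  shows "optimal_cost p c P qs \<le> optimal_cost p c P qs'"
proof -
  have "is_arg_min f (\<lambda>\<pi>. \<pi> \<in> policies) (arg_min_on f policies)"
    if "\<exists>\<pi>. is_arg_min f (\<lambda>\<pi>. \<pi> \<in> policies) \<pi>" for f :: "model \<times> real \<Rightarrow> real"
    using that unfolding arg_min_on_def arg_min_def by (rule someI_ex)
  from this[OF assms(1)] this[OF assms(2)] assms(3) show ?thesis
    unfolding optimal_cost_def is_arg_min_linorder by (meson order_trans)
qed

theorem proposition2: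
  fixes p c t t_hat :: "model \<Rightarrow> real"
    and V P :: real
    and q_pre q_post :: "model \<times> real \<Rightarrow> real"
  assumes "0 < p M1" "p M1 < p M2" "p M2 < 1"
    and "0 \<le> t M1" "t M1 < t M2" "t M2 \<le> 1"
    and "0 \<le> c M1" "c M1 < c M2" "c M2 \<le> 1"
    and "0 < V" "0 < P"
    and "\<And>i. t i < V * p i"
    and "P \<le> min (c M1 / p M1) (c M2 / p M2)"
    and "\<And>i. t_hat i > V * p i"
    and "best_response p V t q_pre"
    and "best_response p V t_hat q_post"
  shows "(\<exists>\<pi>. is_arg_min (induced_cost p c P q_pre) (\<lambda>\<pi>. \<pi> \<in> policies) \<pi>) \<and>
         (\<exists>\<pi>. is_arg_min (induced_cost p c P q_post) (\<lambda>\<pi>. \<pi> \<in> policies) \<pi>) \<and>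
         optimal_cost p c P q_post \<le> optimal_cost p c P q_pre"
proof -
  interpret two_models p by unfold_locales fact+
  have pre: "q_pre \<pi> = 0" and post: "q_post \<pi> = 1" if "\<pi> \<in> policies" for \<pi>
    using best_response_eq_0 best_response_eq_1 assms that by auto
  have "p j > 0" for j
    using assms(1,2) by (cases j) auto
  moreover have "P \<le> c j / p j" for j
    using assms(13) by (cases j) auto
  \<comment> \<open>Serving a call costs at least the penalty it is expected to save.\<close>
  ultimately have margin: "0 \<le> c j - P * p j" for j
    by (simp add: pos_le_divide_eq)
  have "induced_cost p c P q_post \<pi> \<le> induced_cost p c P q_pre \<pi>" if "\<pi> \<in> policies" for \<pi>
    using that margin pre[OF that] post[OF that]
    by (auto simp: induced_cost_def provider_cost_eq policies_def intro!: expected_total_antimono)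
  moreover have "\<exists>\<pi>. is_arg_min (induced_cost p c P q_pre) (\<lambda>\<pi>. \<pi> \<in> policies) \<pi>"
    by (rule exists_cheapest_policy[of 0]) (auto simp: pre)
  moreover have "\<exists>\<pi>. is_arg_min (induced_cost p c P q_post) (\<lambda>\<pi>. \<pi> \<in> policies) \<pi>"
    by (rule exists_cheapest_policy[of 1]) (auto simp: post)
  ultimately show ?thesis
    using optimal_cost_mono by blast
qed

end
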